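(* Let $X$ and $Y$ be non-negative independent random variables with probability density functions, for $x>0$ and $y>0$, $$f(x)=x^{\alpha-1}\sum_{m=1}^{M}a_{m}e^{-\xi_{m}x},\qquad g(y)=y^{\beta-1}\sum_{n=1}^{N}b_{n}e^{-\eta_{n}y},$$ where $\alpha,\beta>0$, $a_m,b_n\in\mathbb{C}$, and $\xi_m,\eta_n\in\mathbb{C}$ satisfy $\operatorname{Re}(\xi_m)>0$ and $\operatorname{Re}(\eta_n)>0$ for all $1\le m\le M$, $1\le n\le N$. Then the probability density function $s(t)=\int_0^t f(t-y)g(y)\,dy$ of the sum $X+Y$ can be written, for $t>0$, as $$s(t)=t^{\alpha+\beta-1}r(t),$$ where $$r(t)=\frac{\Gamma(\alpha)\Gamma(\beta)}{\Gamma(\alpha+\beta)}\sum_{m=1}^{M}a_{m}e^{-\xi_{m}t}\sum_{n=1}^{N}b_{n}\,{}_{1}F_{1}\bigl(\beta,\alpha+\beta;(\xi_{m}-\eta_{n})t\bigr).$$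
   Context: $\Gamma$ is the gamma function and ${}_1F_1$ is the confluent hypergeometric function $${}_{1}F_{1}(a,b;z)=1+\frac{a}{b}\frac{z}{1!}+\frac{a(a+1)}{b(b+1)}\frac{z^{2}}{2!}+\frac{a(a+1)(a+2)}{b(b+1)(b+2)}\frac{z^{3}}{3!}+\cdots.$$ The coefficients $a_m,b_n$ and exponents $\xi_m,\eta_n$ may be complex, but $f$ and $g$ are probability density functions supported on the non-negative half-line. *)

theory Defs
  imports "HOL-Probability.Probability"
begin

(* Kummer's confluent hypergeometric function 1F1(a, b; z).  The series converges for every z
   as long as b is not in {0, -1, -2, ...}; for such b it has no mathematical meaning. *)
definition hyp1F1 :: "complex \<Rightarrow> complex \<Rightarrow> complex \<Rightarrow> complex" where
  "hyp1F1 a b z = (\<Sum>k. pochhammer a k / pochhammer b k * (z ^ k / fact k))"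

end

theory Submission
  imports Defs
begin

text \<open>
  Expanding the convolution integrand turns \<open>s(t)\<close> into a double sum of integrals of
  \<open>(t - y)\<^sup>\<alpha>\<^sup>-\<^sup>1 y\<^sup>\<beta>\<^sup>-\<^sup>1 exp((\<xi>\<^sub>m - \<eta>\<^sub>n) y)\<close> over \<open>[0, t]\<close>. The substitution \<open>y = t u\<close> makes each of them Euler's
  integral for \<open>\<^sub>1F\<^sub>1\<close>, which follows by integrating the exponential series termwise against the
  Beta density; \<open>B(\<beta> + k, \<alpha>) \<le> B(\<beta>, \<alpha>)\<close> dominates the series.
\<close>

text \<open>The known value of the Beta integral is a Henstock-Kurzweil one; absolute integrability
  carries it over to the Lebesgue integral.\<close>

lemma has_bochner_integral_Beta:
  fixes a b :: real
  assumes "a > 0" "b > 0"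
  shows "has_bochner_integral lborel
           (\<lambda>u. indicator {0..1} u *\<^sub>R (u powr (a - 1) * (1 - u) powr (b - 1))) (Beta a b)"
proof -
  have int: "set_integrable lborel {0..1} (\<lambda>u. u powr (a - 1) * (1 - u) powr (b - 1))"
    using integrable_Beta[OF assms] .
  have "(LINT u:{0..1}|lborel. u powr (a - 1) * (1 - u) powr (b - 1)) = Beta a b"
    using set_borel_integral_eq_integral(2)[OF int] has_integral_Beta_real[OF assms]
    by (simp add: integral_unique)
  with int show ?thesis
    by (simp add: has_bochner_integral_iff set_integrable_def set_lebesgue_integral_def)
qed

text \<open>Both Pochhammer symbols are Gamma quotients, as positivity avoids the poles, and
  \<open>Gamma b\<close> cancels. The resulting factor is the k-th coefficient of
  \<open>hyp1F1 a (a + b)\<close>.\<close>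

lemma Beta_pochhammer:
  fixes a b :: real
  assumes "a > 0" "b > 0"
  shows "Beta (a + real k) b = Beta a b * (pochhammer a k / pochhammer (a + b) k)"
proof -
  have "a \<notin> \<int>\<^sub>\<le>\<^sub>0" "a + b \<notin> \<int>\<^sub>\<le>\<^sub>0"
    using assms by (auto elim!: nonpos_Ints_cases)
  moreover have "Gamma a > 0" "Gamma (a + b) > 0" "Gamma (a + b + k) > 0"
    using assms by (auto intro!: Gamma_real_pos)
  ultimately show ?thesis
    by (simp add: Beta_def pochhammer_Gamma field_simps)
qed

lemma Euler_integral_hyp1F1:
  fixes a b :: real and z :: complex
  assumes a: "a > 0" and b: "b > 0"
  shows "has_bochner_integral lborel
           (\<lambda>u. indicator {0..1} u *\<^sub>R
                 (complex_of_real (u powr (a - 1) * (1 - u) powr (b - 1)) * exp (z * of_real u)))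
           (of_real (Beta a b) * hyp1F1 (of_real a) (of_real (a + b)) z)"
proof -
  \<comment> \<open>\<open>h k\<close> is the k-th term of the exponential series times the weight.
    Absorbing \<open>u ^ k\<close> into the exponent of the weight makes its integral a Beta
    value.\<close>
  define w where "w c u = indicator {0..1} u *\<^sub>R (u powr (c - 1) * (1 - u) powr (b - 1))" for c u :: real
  define h where "h k u = complex_of_real (w (a + real k) u) * (z ^ k / fact k)" for k u
  have w: "has_bochner_integral lborel (w (a + real k)) (Beta (a + real k) b)" for k
    unfolding w_def using a b by (intro has_bochner_integral_Beta) auto
  have w_nonneg: "w c u \<ge> 0" for c u
    by (simp add: w_def)
  \<comment> \<open>At u = 0 both sides vanish because \<open>0 powr x = 0\<close> for every x,
    including x = 0; outside the unit interval the indicator is 0.\<close>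
  have w_power: "w (a + real k) u = w a u * u ^ k" for k u
  proof (cases "u \<in> {0<..1}")
    case True
    then have "u powr (a + real k - 1) = u powr (a - 1) * u ^ k"
      by (simp add: powr_realpow [symmetric] powr_add [symmetric] algebra_simps)
    then show ?thesis by (simp add: w_def)
  qed (auto simp: w_def indicator_def)
  have h: "has_bochner_integral lborel (h k) (of_real (Beta (a + real k) b) * (z ^ k / fact k))" for k
    unfolding h_def by (intro has_bochner_integral_mult_left has_bochner_integral_of_real w)
  have h_eq: "h k u = of_real (w a u) * ((z * of_real u) ^ k /\<^sub>R fact k)" for k u
    by (simp add: h_def w_power scaleR_conv_of_real power_mult_distrib field_simps)
  have h_sums: "(\<lambda>k. h k u) sums (of_real (w a u) * exp (z * of_real u))" for u
    unfolding h_eq by (intro sums_mult exp_converges)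
  have norm_h: "norm (h k u) = w (a + real k) u * (norm z ^ k / fact k)" for k u
    by (simp add: h_def norm_mult norm_divide norm_power w_nonneg)
  have norm_h_sum: "summable (\<lambda>k. norm (h k u))" for u
  proof -
    have "summable (\<lambda>k. norm (w a u) * (norm (z * of_real u) ^ k /\<^sub>R fact k))"
      by (intro summable_mult summable_exp_generic)
    then show ?thesis
      by (simp add: h_eq norm_mult norm_power mult_ac del: summable_cmult_iff)
  qed
  have int_norm: "(LINT u|lborel. norm (h k u)) = Beta (a + real k) b * (norm z ^ k / fact k)" for k
    unfolding norm_h using has_bochner_integral_integral_eq[OF has_bochner_integral_mult_left[OF w]]
    by blast
  have sum_int: "summable (\<lambda>k. LINT u|lborel. norm (h k u))"
    unfolding int_norm
  proof (rule summable_comparison_test')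
    show "summable (\<lambda>k. Beta a b * (norm z ^ k / fact k))"
      using summable_exp_generic[of "norm z"] by (intro summable_mult) (simp add: field_simps)
    fix k :: nat
    have "0 \<le> Beta (a + real k) b"
      using a b by (simp add: Beta_def Gamma_real_nonneg)
    moreover have "Beta (a + real k) b \<le> Beta a b"
      using a b by (intro Beta_real_mono) auto
    ultimately show "norm (Beta (a + real k) b * (norm z ^ k / fact k)) \<le> Beta a b * (norm z ^ k / fact k)"
      by (simp add: abs_mult mult_right_mono divide_right_mono)
  qed
  have int_h: "integrable lborel (h k)" for k
    using h by (simp add: has_bochner_integral_iff)
  have "has_bochner_integral lborel (\<lambda>u. \<Sum>k. h k u) (\<Sum>k. LINT u|lborel. h k u)"
    using integrable_suminf[OF int_h _ sum_int] integral_suminf[OF int_h _ sum_int] norm_h_sum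
    by (simp add: has_bochner_integral_iff)
  moreover have "(\<Sum>k. h k u) = indicator {0..1} u *\<^sub>R
      (complex_of_real (u powr (a - 1) * (1 - u) powr (b - 1)) * exp (z * of_real u))" for u
    using sums_unique[OF h_sums[of u], symmetric] by (simp add: w_def scaleR_conv_of_real)
  moreover have "(\<Sum>k. LINT u|lborel. h k u) = of_real (Beta a b) * hyp1F1 (of_real a) (of_real (a + b)) z"
  proof -
    have eq: "(LINT u|lborel. h k u) = of_real (Beta a b) *
        (pochhammer (of_real a) k / pochhammer (of_real (a + b)) k * (z ^ k / fact k))" for k
      using has_bochner_integral_integral_eq[OF h[of k]]
      by (simp add: Beta_pochhammer[OF a b] pochhammer_of_real flip: of_real_add)
    \<comment> \<open>The \<open>suminf\<close> in \<open>hyp1F1\<close> can absorb the constant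
      once its series is known to converge. Cancelling this nonzero factor derives that from the
      convergence of the series of integrals.\<close>
    have "complex_of_real (Beta a b) \<noteq> 0"
      using Gamma_real_pos[OF a] Gamma_real_pos[OF b] Gamma_real_pos[OF add_pos_pos[OF a b]]
      by (simp add: Beta_def)
    moreover have "summable (\<lambda>k. LINT u|lborel. h k u)"
      using summable_integral[OF int_h _ sum_int] norm_h_sum by simp
    ultimately have "summable (\<lambda>k. pochhammer (complex_of_real a) k /
        pochhammer (of_real (a + b)) k * (z ^ k / fact k))"
      unfolding eq by (rule summable_mult_D[rotated])
    then show ?thesis
      unfolding eq hyp1F1_def by (rule suminf_mult)
  qed
  ultimately show ?thesis by simp
qed

text \<open>Under y = t u the weight contributes t to the power (a - 1) + (b - 1), and dy
  contributes one more factor t. Here y carries the exponent b - 1, so Euler's integral is used with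
  a and b exchanged.\<close>

lemma Euler_integral_hyp1F1_scaled:
  fixes a b t :: real and z :: complex
  assumes a: "a > 0" and b: "b > 0" and t: "t > 0"
  shows "has_bochner_integral lborel
           (\<lambda>y. indicator {0..t} y *\<^sub>R
                 (complex_of_real ((t - y) powr (a - 1) * y powr (b - 1)) * exp (z * of_real y)))
           (of_real (t powr (a + b - 1) * Beta a b) * hyp1F1 (of_real b) (of_real (a + b)) (z * of_real t))"
    (is "has_bochner_integral _ ?F ?I")
proof -
  define G where "G u = indicator {0..1} u *\<^sub>R
    (complex_of_real (u powr (b - 1) * (1 - u) powr (a - 1)) * exp (z * of_real t * of_real u))" for u :: real
  have "has_bochner_integral lborel G
      (of_real (Beta a b) * hyp1F1 (of_real b) (of_real (a + b)) (z * of_real t))"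
    using Euler_integral_hyp1F1[OF b a, of "z * of_real t"]
    by (simp add: G_def [abs_def] Beta_commute add.commute)
  then have "has_bochner_integral lborel (\<lambda>u. of_real (t powr (a + b - 2)) * G u)
      (of_real (t powr (a + b - 2)) * (of_real (Beta a b) * hyp1F1 (of_real b) (of_real (a + b)) (z * of_real t)))"
    by (rule has_bochner_integral_mult_right)
  \<comment> \<open>The form \<open>0 + t * u\<close> matches the affine change of variables for
    \<open>lborel\<close>, whose Jacobian appears below as division by
    \<open>\<bar>t\<bar>\<close>.\<close>
  moreover have "of_real (t powr (a + b - 2)) * G u = ?F (0 + t * u)" for u
  proof (cases "u \<in> {0..1}")
    case True
    then have "t * u \<in> {0..t}"
      using t by (simp add: mult_left_le)
    moreover have "t powr (a + b - 2) * (u powr (b - 1) * (1 - u) powr (a - 1)) =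
        (t - t * u) powr (a - 1) * (t * u) powr (b - 1)"
    proof -
      have "(t - t * u) powr (a - 1) = t powr (a - 1) * (1 - u) powr (a - 1)"
        using True t powr_mult[of t "1 - u" "a - 1"] by (simp add: algebra_simps)
      moreover have "t powr (a + b - 2) = t powr (a - 1) * t powr (b - 1)"
        by (simp flip: powr_add)
      ultimately show ?thesis
        using True t by (simp add: powr_mult)
    qed
    then have "of_real (t powr (a + b - 2)) * complex_of_real (u powr (b - 1) * (1 - u) powr (a - 1)) =
        of_real ((t - t * u) powr (a - 1) * (t * u) powr (b - 1))"
      by (simp flip: of_real_mult)
    ultimately show ?thesis
      using True by (simp add: G_def mult_ac)
  next
    case False
    then have "t * u \<notin> {0..t}"
      using t by (auto simp: zero_le_mult_iff)
    with False show ?thesis by (simp add: G_def)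
  qed
  moreover have "of_real (t powr (a + b - 2)) * (of_real (Beta a b) *
      hyp1F1 (of_real b) (of_real (a + b)) (z * of_real t)) = ?I /\<^sub>R \<bar>t\<bar>"
  proof -
    have "t powr (a + b - 1) = t * t powr (a + b - 2)"
      using t powr_add[of t 1 "a + b - 2"] by simp
    then show ?thesis
      using t by (simp add: scaleR_conv_of_real)
  qed
  ultimately have "has_bochner_integral lborel (\<lambda>u. ?F (0 + t * u)) (?I /\<^sub>R \<bar>t\<bar>)"
    by (simp only:)
  then show ?thesis
    using lborel_has_bochner_integral_real_affine_iff[of t ?F ?I 0] t by blast
qed

text \<open>The exponentials combine as exp(-\<xi>(t - y)) exp(-\<eta> y) = exp(-\<xi> t) exp((\<xi>
  - \<eta>) y), so the first factor leaves the integral. The integrand is embedded in the complex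
  numbers because the single terms need not be real.\<close>

lemma has_bochner_integral_exp_poly_convolution:
  fixes f g :: "real \<Rightarrow> real" and \<alpha> \<beta> t :: real and a b \<xi> \<eta> :: "'i \<Rightarrow> complex"
  assumes \<alpha>: "\<alpha> > 0" and \<beta>: "\<beta> > 0" and t: "t > 0"
    and [measurable]: "f \<in> borel_measurable borel" "g \<in> borel_measurable borel"
    and f: "\<And>x. x > 0 \<Longrightarrow> complex_of_real (f x) =
           of_real (x powr (\<alpha> - 1)) * (\<Sum>m\<in>A. a m * exp (- \<xi> m * of_real x))"
    and g: "\<And>y. y > 0 \<Longrightarrow> complex_of_real (g y) =
           of_real (y powr (\<beta> - 1)) * (\<Sum>n\<in>B. b n * exp (- \<eta> n * of_real y))"
  shows "has_bochner_integral lborel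
           (\<lambda>y. complex_of_real (indicator {0..t} y *\<^sub>R (f (t - y) * g y)))
           (of_real (t powr (\<alpha> + \<beta> - 1)) * (of_real (Beta \<alpha> \<beta>) *
             (\<Sum>m\<in>A. a m * exp (- \<xi> m * of_real t) *
               (\<Sum>n\<in>B. b n * hyp1F1 (of_real \<beta>) (of_real (\<alpha> + \<beta>)) ((\<xi> m - \<eta> n) * of_real t)))))"
    (is "has_bochner_integral _ ?F ?I")
proof -
  let ?c = "\<lambda>m n. a m * exp (- \<xi> m * of_real t) * b n"
  let ?w = "\<lambda>y. complex_of_real ((t - y) powr (\<alpha> - 1) * y powr (\<beta> - 1))"
  let ?E = "\<lambda>m n y. exp ((\<xi> m - \<eta> n) * complex_of_real y)"
  let ?T = "\<lambda>m n y. ?c m n * (indicator {0..t} y *\<^sub>R (?w y * ?E m n y))"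
  have T: "has_bochner_integral lborel (\<lambda>y. \<Sum>m\<in>A. \<Sum>n\<in>B. ?T m n y)
      (\<Sum>m\<in>A. \<Sum>n\<in>B. ?c m n * (of_real (t powr (\<alpha> + \<beta> - 1) * Beta \<alpha> \<beta>) *
        hyp1F1 (of_real \<beta>) (of_real (\<alpha> + \<beta>)) ((\<xi> m - \<eta> n) * of_real t)))"
    by (intro has_bochner_integral_sum has_bochner_integral_mult_right
          Euler_integral_hyp1F1_scaled \<alpha> \<beta> t)
  \<comment> \<open>The formulas for f and g are given at positive arguments only, so the endpoints
    y = 0 and y = t are set aside as a null set.\<close>
  have eq: "?F y = (\<Sum>m\<in>A. \<Sum>n\<in>B. ?T m n y)" if "y \<noteq> 0" "y \<noteq> t" for y
  proof (cases "y \<in> {0..t}")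
    case True
    with that have y: "y > 0" "t - y > 0" by auto
    have exp_eq: "exp (- \<xi> m * of_real (t - y)) * exp (- \<eta> n * of_real y) =
        exp (- \<xi> m * of_real t) * ?E m n y" for m n
      by (simp add: exp_add [symmetric] algebra_simps)
    have "?F y = complex_of_real (f (t - y)) * complex_of_real (g y)"
      using True by simp
    also have "\<dots> = (\<Sum>m\<in>A. \<Sum>n\<in>B. ?w y * (a m * b n *
        (exp (- \<xi> m * of_real (t - y)) * exp (- \<eta> n * of_real y))))"
      unfolding f[OF y(2)] g[OF y(1)]
      by (simp add: sum_product sum_distrib_left sum_distrib_right mult_ac del: of_real_diff)
    also have "\<dots> = (\<Sum>m\<in>A. \<Sum>n\<in>B. ?T m n y)"
      unfolding exp_eq using True by (simp add: mult_ac)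
    finally show ?thesis .
  qed simp
  have "AE y in lborel. ?F y = (\<Sum>m\<in>A. \<Sum>n\<in>B. ?T m n y)"
    using AE_lborel_singleton[of 0] AE_lborel_singleton[of t] by eventually_elim (rule eq)
  moreover have "(\<Sum>m\<in>A. \<Sum>n\<in>B. ?c m n * (of_real (t powr (\<alpha> + \<beta> - 1) * Beta \<alpha> \<beta>) *
        hyp1F1 (of_real \<beta>) (of_real (\<alpha> + \<beta>)) ((\<xi> m - \<eta> n) * of_real t))) = ?I"
    by (simp add: sum_distrib_left mult_ac)
  ultimately show ?thesis
    using T by (subst has_bochner_integral_cong_AE) auto
qed

theorem lemma2p1:
  fixes P :: "'a measure"
    and X Y :: "'a \<Rightarrow> real"
    and f g s :: "real \<Rightarrow> real"
    and r :: "real \<Rightarrow> complex"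
    and \<alpha> \<beta> :: real
    and M N :: nat
    and a b \<xi> \<eta> :: "nat \<Rightarrow> complex"
  assumes "prob_space P"
    and "prob_space.indep_var P borel X borel Y"
    and "AE \<omega> in P. 0 \<le> X \<omega>"
    and "AE \<omega> in P. 0 \<le> Y \<omega>"
    and "distributed P lborel X (\<lambda>x. ennreal (f x))"
    and "distributed P lborel Y (\<lambda>y. ennreal (g y))"
    and "\<And>x. 0 \<le> f x"
    and "\<And>y. 0 \<le> g y"
    and "\<And>x. x < 0 \<Longrightarrow> f x = 0"
    and "\<And>y. y < 0 \<Longrightarrow> g y = 0"
    and "\<alpha> > 0"
    and "\<beta> > 0"
    and "\<And>m. m \<in> {1..M} \<Longrightarrow> Re (\<xi> m) > 0"
    and "\<And>n. n \<in> {1..N} \<Longrightarrow> Re (\<eta> n) > 0"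
    and "\<And>x. x > 0 \<Longrightarrow> complex_of_real (f x) =
           complex_of_real (x powr (\<alpha> - 1)) *
             (\<Sum>m=1..M. a m * exp (- \<xi> m * complex_of_real x))"
    and "\<And>y. y > 0 \<Longrightarrow> complex_of_real (g y) =
           complex_of_real (y powr (\<beta> - 1)) *
             (\<Sum>n=1..N. b n * exp (- \<eta> n * complex_of_real y))"
    and s_def: "\<And>t. s t = (LINT y:{0..t}|lborel. f (t - y) * g y)"
    and r_def: "\<And>t. r t =
           complex_of_real (Gamma \<alpha> * Gamma \<beta> / Gamma (\<alpha> + \<beta>)) *
             (\<Sum>m=1..M. a m * exp (- \<xi> m * complex_of_real t) *
               (\<Sum>n=1..N. b n *
                 hyp1F1 (complex_of_real \<beta>) (complex_of_real (\<alpha> + \<beta>))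
                   ((\<xi> m - \<eta> n) * complex_of_real t)))"
  shows "distributed P lborel (\<lambda>\<omega>. X \<omega> + Y \<omega>) (\<lambda>t. ennreal (s t))
    \<and> (\<forall>t>0. set_integrable lborel {0..t} (\<lambda>y. f (t - y) * g y)
         \<and> complex_of_real (s t) = complex_of_real (t powr (\<alpha> + \<beta> - 1)) * r t)"
proof -
  interpret prob_space P by fact
  have f_meas [measurable]: "f \<in> borel_measurable borel" and g_meas [measurable]: "g \<in> borel_measurable borel"
    using distributed_real_measurable[OF _ assms(5)] distributed_real_measurable[OF _ assms(6)] assms(7,8)
    by auto
  have conv: "has_bochner_integral lborel
      (\<lambda>y. complex_of_real (indicator {0..t} y *\<^sub>R (f (t - y) * g y)))
      (of_real (t powr (\<alpha> + \<beta> - 1)) * r t)" if "t > 0" for t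
    unfolding r_def
    using has_bochner_integral_exp_poly_convolution[OF assms(11,12) that f_meas g_meas assms(15,16)]
    by (simp add: Beta_def)
  have int: "set_integrable lborel {0..t} (\<lambda>y. f (t - y) * g y)" if "t > 0" for t
    using conv[OF that] unfolding set_integrable_def has_bochner_integral_iff
    by (simp only: complex_of_real_integrable_eq)
  have s_eq: "complex_of_real (s t) = of_real (t powr (\<alpha> + \<beta> - 1)) * r t" if "t > 0" for t
    using has_bochner_integral_integral_eq[OF conv[OF that]]
    unfolding s_def set_lebesgue_integral_def by (simp only: integral_complex_of_real)
  \<comment> \<open>The domain \<open>{0..t}\<close> moves with t. Written as inequalities, its
    indicator is jointly measurable in t and y, hence so is the integrand, and the integral is
    measurable in t.\<close>
  have s_meas [measurable]: "s \<in> borel_measurable borel"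
    unfolding s_def [abs_def] set_lebesgue_integral_def indicator_def atLeastAtMost_iff by measurable
  \<comment> \<open>Densities matter only almost everywhere, so t = 0 may be left out: there
    \<open>{0..t}\<close> is not empty, yet \<open>int\<close> covers only t > 0.\<close>
  have density: "(\<integral>\<^sup>+y. ennreal (f (t - y)) * ennreal (g y) \<partial>lborel) = ennreal (s t)"
    if "t \<noteq> 0" for t
  proof -
    \<comment> \<open>For y > t the factor \<open>f (t - y)\<close> vanishes and for y < 0 the
      factor \<open>g y\<close> does, so the convolution over the whole line reduces to
      \<open>{0..t}\<close>.\<close>
    have supp: "ennreal (f (t - y)) * ennreal (g y) = ennreal (indicator {0..t} y *\<^sub>R (f (t - y) * g y))" for y
      using assms(7-10)
      by (cases "y < 0"; cases "t < y") (auto simp: ennreal_mult indicator_def)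
    show ?thesis
    proof (cases "t > 0")
      case True
      then show ?thesis
        unfolding supp s_def set_lebesgue_integral_def
        using int[OF True, unfolded set_integrable_def] assms(7,8)
        by (intro nn_integral_eq_integral) auto
    next
      case False
      with that have "{0..t} = {}" by simp
      then show ?thesis
        unfolding supp s_def by (simp add: set_lebesgue_integral_def)
    qed
  qed
  \<comment> \<open>Independence gives the whole-line convolution as a density of the sum; it is
    then replaced by s through almost everywhere equality.\<close>
  have "distributed P lborel (\<lambda>\<omega>. X \<omega> + Y \<omega>)
      (\<lambda>t. \<integral>\<^sup>+y. ennreal (f (t - y)) * ennreal (g y) \<partial>lborel)"
    by (rule distributed_convolution[OF assms(2,5,6)])
  moreover have "AE t in lborel. (\<integral>\<^sup>+y. ennreal (f (t - y)) * ennreal (g y) \<partial>lborel) = ennreal (s t)"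
    using AE_lborel_singleton[of 0] by eventually_elim (rule density)
  ultimately have "distributed P lborel (\<lambda>\<omega>. X \<omega> + Y \<omega>) (\<lambda>t. ennreal (s t))"
    by (subst (asm) distributed_cong_density) (auto intro: distributed_borel_measurable)
  with int s_eq show ?thesis by blast
qed

end
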